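(* Let $G$ be a graph. (1) For every edge $e=(x,y)$ joining two distinct non-adjacent vertices $x,y$ of $G$, $$\frac{mp(G)+1}{3} \leq mp(G+e) \leq 3\,mp(G).$$ (2) For every edge $e$ of $G$, $$\frac{mp(G)}{3} \leq mp(G-e) \leq 3\,mp(G)-1.$$ Moreover, all four of these bounds are sharp: for each of the four inequalities there exist a graph $G$ and an edge $e$ of the corresponding kind for which equality holds.
   Context: All graphs are finite, simple, undirected, with non-empty vertex set. A path $v_1v_2\ldots v_k$ (distinct vertices, consecutive ones adjacent, $k\ge 1$) in a graph $G$ is degree monotone if $\deg(v_1)\le \deg(v_2)\le\dots\le\deg(v_k)$ or $\deg(v_1)\ge\deg(v_2)\ge\dots\ge\deg(v_k)$, where degrees are taken in $G$. The length of a degree monotone path is its number of vertices, and $mp(G)$ is the maximum length of a degree monotone path in $G$ (so $mp(G)=1$ if $G$ has no edges). $G+e$ is the graph obtained from $G$ by adding an edge $e$ between two non-adjacent vertices of $G$; $G-e$ is the graph obtained from $G$ by deleting the edge $e$ (keeping all vertices). *)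

theory Defs
  imports Complex_Main
begin

record 'a graph =
  verts :: "'a set"
  edges :: "'a set set"

text \<open>Edges are two-element sets of vertices, so graphs are undirected, without loops and
  without multiple edges.\<close>

definition simple_graph :: "'a graph \<Rightarrow> bool" where
  "simple_graph G \<longleftrightarrow> finite (verts G) \<and> verts G \<noteq> {} \<and>
     (\<forall>e\<in>edges G. e \<subseteq> verts G \<and> card e = 2)"

definition adjacent :: "'a graph \<Rightarrow> 'a \<Rightarrow> 'a \<Rightarrow> bool" where
  "adjacent G x y \<longleftrightarrow> {x, y} \<in> edges G"

definition degree :: "'a graph \<Rightarrow> 'a \<Rightarrow> nat" where
  "degree G v = card {u \<in> verts G. adjacent G v u}"

definition is_path :: "'a graph \<Rightarrow> 'a list \<Rightarrow> bool" where
  "is_path G p \<longleftrightarrow> p \<noteq> [] \<and> set p \<subseteq> verts G \<and> distinct p \<and> successively (adjacent G) p"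

definition degree_monotone_path :: "'a graph \<Rightarrow> 'a list \<Rightarrow> bool" where
  "degree_monotone_path G p \<longleftrightarrow> is_path G p \<and>
     (sorted_wrt (\<le>) (map (degree G) p) \<or> sorted_wrt (\<ge>) (map (degree G) p))"

text \<open>For a simple graph the set below is finite and nonempty, so the maximum is attained.
  The length of a path is its number of vertices.\<close>

definition mp :: "'a graph \<Rightarrow> nat" where
  "mp G = Max {length p |p. degree_monotone_path G p}"

definition add_edge :: "'a graph \<Rightarrow> 'a set \<Rightarrow> 'a graph" where
  "add_edge G e = G\<lparr>edges := insert e (edges G)\<rparr>"

definition delete_edge :: "'a graph \<Rightarrow> 'a set \<Rightarrow> 'a graph" where
  "delete_edge G e = G\<lparr>edges := edges G - {e}\<rparr>"

text \<open>The set of edges that can be added to a graph.\<close>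

definition non_edges :: "'a graph \<Rightarrow> 'a set set" where
  "non_edges G = {{x, y} |x y. x \<in> verts G \<and> y \<in> verts G \<and> x \<noteq> y \<and> \<not> adjacent G x y}"

end

theory Submission
  imports Defs
begin

text \<open>Adding the edge \<open>xy\<close> raises only the degrees of \<open>x\<close> and \<open>y\<close>, by one each. Read a degree
  monotone path upwards and write it as \<open>A x B y C\<close>. If it is monotone in \<open>G + xy\<close>, then
  \<open>A\<close>, \<open>x B\<close> and \<open>y C\<close> are monotone in \<open>G\<close>, since there the degrees of their first vertices
  can only drop. If it is monotone in \<open>G\<close>, then \<open>A x\<close>, \<open>B y\<close> and \<open>C\<close> are monotone in \<open>G + xy\<close>,
  and so is \<open>A x y\<close>, which saves one vertex. Deleting an edge is the inverse operation.
  The upper bound is attained by a caterpillar on 10 vertices, the lower bound by a graph on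
  15 vertices.\<close>

section \<open>Degree monotone paths read upwards\<close>

definition climb :: "'a graph \<Rightarrow> 'a \<Rightarrow> 'a \<Rightarrow> bool" where
  "climb G u v \<longleftrightarrow> adjacent G u v \<and> degree G u \<le> degree G v"

definition climbing_path :: "'a graph \<Rightarrow> 'a list \<Rightarrow> bool" where
  "climbing_path G p \<longleftrightarrow> set p \<subseteq> verts G \<and> distinct p \<and> successively (climb G) p"

lemma successively_conj:
  "successively (\<lambda>u v. P u v \<and> Q u v) xs \<longleftrightarrow> successively P xs \<and> successively Q xs"
  by (induction xs rule: induct_list012) auto

text \<open>No step leads into the head \<open>u\<close>, so \<open>Q\<close> has to be known only
  for steps that end in \<open>xs\<close>. This lets a piece of a path start at an end of the new
  edge.\<close>

lemma successively_Cons_mono: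
  assumes "successively P (u # xs)" "\<And>a b. P a b \<Longrightarrow> b \<in> set xs \<Longrightarrow> Q a b"
  shows "successively Q (u # xs)"
  using assms by (induction xs arbitrary: u) auto

text \<open>Dually, no step leaves the last element, so a piece may finish at an end of the new
  edge.\<close>

lemma successively_snoc_mono:
  assumes "successively P (xs @ [u])" "\<And>a b. P a b \<Longrightarrow> a \<in> set xs \<Longrightarrow> Q a b"
  shows "successively Q (xs @ [u])"
  using assms by (induction xs rule: induct_list012) auto

lemma climbing_path_appendD:
  assumes "climbing_path G (xs @ ys)"
  shows "climbing_path G xs" "climbing_path G ys"
  using assms by (auto simp: climbing_path_def successively_append_iff)

lemma adjacent_commute: "adjacent G u v \<longleftrightarrow> adjacent G v u"
  by (simp add: adjacent_def insert_commute)

lemma successively_climb: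
  "successively (climb G) p \<longleftrightarrow>
    successively (adjacent G) p \<and> successively (\<lambda>u v. degree G u \<le> degree G v) p"
  using successively_conj[of "adjacent G" "\<lambda>u v. degree G u \<le> degree G v" p]
  by (simp add: climb_def[abs_def])

text \<open>Transitivity reduces sortedness to consecutive degrees, and a descending path is an
  ascending one reversed.\<close>

lemma degree_monotone_path_iff_climbing:
  "degree_monotone_path G p \<longleftrightarrow> p \<noteq> [] \<and> (climbing_path G p \<or> climbing_path G (rev p))"
proof -
  have le: "sorted_wrt (\<le>) (map (degree G) p)
      \<longleftrightarrow> successively (\<lambda>u v. degree G u \<le> degree G v) p"
    by (simp add: successively_conv_sorted_wrt[symmetric] transp_def successively_map)
  have ge: "sorted_wrt (\<ge>) (map (degree G) p)
      \<longleftrightarrow> successively (\<lambda>u v. degree G v \<le> degree G u) p"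
    by (simp add: successively_conv_sorted_wrt[symmetric] transp_def successively_map)
  have rev: "(\<lambda>u v. climb G v u) = (\<lambda>u v. adjacent G u v \<and> degree G v \<le> degree G u)"
    by (intro ext) (auto simp: climb_def adjacent_commute)
  show ?thesis
    unfolding degree_monotone_path_def is_path_def climbing_path_def successively_rev le ge rev
      successively_climb successively_conj set_rev distinct_rev by blast
qed

section \<open>Estimating the maximum length\<close>

lemma finite_degree_monotone_path_lengths:
  assumes "simple_graph G"
  shows "finite {length p |p. degree_monotone_path G p}"
proof (rule finite_subset)
  have "length p \<le> card (verts G)" if "degree_monotone_path G p" for p
    using that assms distinct_card[of p] card_mono[of "verts G" "set p"]
    by (simp add: degree_monotone_path_def is_path_def simple_graph_def)
  then show "{length p |p. degree_monotone_path G p} \<subseteq> {..card (verts G)}"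
    by auto
qed simp

lemma length_climbing_path_le_mp:
  assumes "simple_graph G" "climbing_path G p"
  shows "length p \<le> mp G"
proof (cases "p = []")
  case False
  then show ?thesis
    unfolding mp_def using assms finite_degree_monotone_path_lengths
    by (intro Max_ge) (auto simp: degree_monotone_path_iff_climbing)
qed simp

lemma mp_pos:
  assumes "simple_graph G"
  shows "mp G > 0"
proof -
  from assms obtain v where "v \<in> verts G"
    by (auto simp: simple_graph_def)
  then have "climbing_path G [v]"
    by (simp add: climbing_path_def)
  from length_climbing_path_le_mp[OF assms this] show ?thesis
    by simp
qed

lemma mp_leI:
  assumes "simple_graph G" "\<And>p. climbing_path G p \<Longrightarrow> length p \<le> k"
  shows "mp G \<le> k"
proof -
  from assms(1) obtain v where "v \<in> verts G"
    by (auto simp: simple_graph_def)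
  then have "degree_monotone_path G [v]"
    by (simp add: degree_monotone_path_def is_path_def)
  then have "{length p |p. degree_monotone_path G p} \<noteq> {}"
    by blast
  moreover have "length p \<le> k" if "degree_monotone_path G p" for p
    using that assms(2)[of p] assms(2)[of "rev p"] by (auto simp: degree_monotone_path_iff_climbing)
  then have "\<forall>n \<in> {length p |p. degree_monotone_path G p}. n \<le> k"
    by blast
  ultimately show ?thesis
    unfolding mp_def using finite_degree_monotone_path_lengths[OF assms(1)] by simp
qed

text \<open>The levels \<open>l\<close> increase strictly along an ascending path, so its vertices
  have distinct levels, of which there are only \<open>k\<close>. For concrete graphs this replaces
  an enumeration of paths by a check of edges.\<close>

lemma mp_le_levels:
  fixes l :: "'a \<Rightarrow> nat"
  assumes "simple_graph G"
    and less: "\<And>u v. u \<in> verts G \<Longrightarrow> v \<in> verts G \<Longrightarrow> climb G u v \<Longrightarrow> l u < l v"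
    and bound: "\<And>v. v \<in> verts G \<Longrightarrow> l v < k"
  shows "mp G \<le> k"
proof (rule mp_leI[OF assms(1)])
  fix p assume p: "climbing_path G p"
  then have "successively (climb G) p" and sub: "set p \<subseteq> verts G"
    by (simp_all add: climbing_path_def)
  from this(1) have "successively (\<lambda>u v. l u < l v) p"
    by (rule successively_mono) (use sub less in blast)
  then have "sorted_wrt (<) (map l p)"
    by (simp add: successively_conv_sorted_wrt[symmetric] transp_def successively_map)
  then have "distinct (map l p)"
    by (simp add: strict_sorted_iff)
  moreover have "set (map l p) \<subseteq> {..<k}"
    using p bound by (auto simp: climbing_path_def)
  ultimately have "card (set (map l p)) = length p" "card (set (map l p)) \<le> k"
    using card_mono[of "{..<k}" "set (map l p)"] distinct_card[of "map l p"] by auto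
  then show "length p \<le> k"
    by simp
qed

section \<open>Splitting a path at the ends of the edge\<close>

text \<open>In the last case \<open>{u, v} = {x, y}\<close> leaves open which end comes first, so
  both orders are treated at once.\<close>

lemma distinct_list_split2_cases:
  assumes "distinct p"
  obtains (none) "x \<notin> set p" "y \<notin> set p"
  | (one) z A B where "p = A @ z # B" "{x, y} \<inter> set A = {}" "{x, y} \<inter> set B = {}"
  | (two) u v A B C where "p = A @ u # B @ v # C" "{u, v} = {x, y}"
      "{x, y} \<inter> set A = {}" "{x, y} \<inter> set B = {}" "{x, y} \<inter> set C = {}"
proof -
  have *: thesis if "u \<in> set p" "{u, v} = {x, y}" "v \<notin> set p" for u v
  proof -
    from that(1) obtain A B where p: "p = A @ u # B"
      by (meson split_list)
    show thesis
      by (rule one[OF p]) (use that assms p in auto)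
  qed
  have **: thesis if "p = A @ u # D" "{u, v} = {x, y}" "v \<in> set D" for u v A D
  proof -
    from that(3) obtain B C where D: "D = B @ v # C"
      by (meson split_list)
    show thesis
      by (rule two[of A u B v C]) (use that assms D in auto)
  qed
  consider "x \<notin> set p" "y \<notin> set p" | "x \<in> set p" "y \<notin> set p" | "x \<notin> set p" "y \<in> set p"
    | "x \<in> set p" "y \<in> set p" "x = y" | "x \<in> set p" "y \<in> set p" "x \<noteq> y"
    by blast
  then show thesis
  proof cases
    case 4
    obtain A B where p: "p = A @ x # B"
      using 4 by (meson split_list)
    show thesis
      by (rule one[OF p]) (use 4 assms p in auto)
  next
    case 5
    obtain A D where p: "p = A @ x # D"
      using 5 by (meson split_list)
    show thesis
    proof (cases "y \<in> set D")
      case True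
      with p ** show thesis by blast
    next
      case False
      with 5 p have "y \<in> set A" by auto
      then obtain A' B where "A = A' @ y # B"
        by (meson split_list)
      with p have "p = A' @ y # (B @ x # D)" by simp
      from **[OF this, of x] show thesis
        by (simp add: insert_commute)
    qed
  qed (use none * in \<open>auto simp: insert_commute\<close>)
qed

section \<open>Bounds for adding an edge\<close>

lemma verts_add_edge [simp]: "verts (add_edge G e) = verts G"
  by (simp add: add_edge_def)

context
  fixes G :: "'a graph" and x y :: 'a
  assumes G: "simple_graph G" and xy: "x \<in> verts G" "y \<in> verts G" "x \<noteq> y" "\<not> adjacent G x y"
begin

lemma simple_graph_add_edge: "simple_graph (add_edge G {x, y})"
  using G xy by (simp add: simple_graph_def add_edge_def)

lemma adjacent_add_edge:
  "adjacent (add_edge G {x, y}) u v \<longleftrightarrow> {u, v} = {x, y} \<or> adjacent G u v"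
  by (auto simp: adjacent_def add_edge_def)

lemma degree_add_edge_other:
  assumes "v \<notin> {x, y}"
  shows "degree (add_edge G {x, y}) v = degree G v"
proof -
  have "{v, u} \<noteq> {x, y}" for u
    using assms by auto
  then show ?thesis
    by (simp add: degree_def adjacent_add_edge)
qed

lemma degree_add_edge_end:
  assumes "v \<in> {x, y}"
  shows "degree (add_edge G {x, y}) v = Suc (degree G v)"
proof -
  obtain w where w: "{v, w} = {x, y}" "w \<in> verts G" "\<not> adjacent G v w"
    using assms xy adjacent_commute by (metis insertE insert_commute singletonD)
  then have "{u \<in> verts G. adjacent (add_edge G {x, y}) v u}
      = insert w {u \<in> verts G. adjacent G v u}"
    by (auto simp: adjacent_add_edge doubleton_eq_iff)
  then show ?thesis
    using G w by (simp add: degree_def simple_graph_def)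
qed

lemma degree_le_add_edge: "degree G v \<le> degree (add_edge G {x, y}) v"
  using degree_add_edge_other degree_add_edge_end by (metis le_SucI order_refl)

text \<open>As \<open>v\<close> is not an end, the step does not use the new edge and
  \<open>v\<close> keeps its degree, while the degree of \<open>u\<close> can only drop.\<close>

lemma climb_add_edge_imp_climb:
  assumes "climb (add_edge G {x, y}) u v" "v \<notin> {x, y}"
  shows "climb G u v"
  using assms degree_le_add_edge[of u] degree_add_edge_other[of v]
  by (auto simp: climb_def adjacent_add_edge)

lemma climb_imp_climb_add_edge:
  assumes "climb G u v" "u \<notin> {x, y}"
  shows "climb (add_edge G {x, y}) u v"
  using assms degree_le_add_edge[of v] degree_add_edge_other[of u]
  by (auto simp: climb_def adjacent_add_edge)

lemma mp_add_edge_le: "mp (add_edge G {x, y}) \<le> 3 * mp G"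
proof -
  let ?G = "add_edge G {x, y}"
  show ?thesis
  proof (rule mp_leI[OF simple_graph_add_edge])
    fix p assume p: "climbing_path ?G p"
    have tail: "length (z # D) \<le> mp G"
      if "climbing_path ?G (z # D)" "{x, y} \<inter> set D = {}" for z D
      using that by (intro length_climbing_path_le_mp[OF G])
        (auto simp: climbing_path_def simp del: successively.simps
          elim!: successively_Cons_mono intro!: climb_add_edge_imp_climb)
    have free: "length D \<le> mp G"
      if "climbing_path ?G D" "{x, y} \<inter> set D = {}" for D
      using that tail by (cases D) auto
    from p have "distinct p"
      by (simp add: climbing_path_def)
    then show "length p \<le> 3 * mp G"
    proof (cases rule: distinct_list_split2_cases[where x = x and y = y])
      case none
      then show ?thesis
        using p free[of p] by simp
    next
      case (one z A B)
      have "length A \<le> mp G"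
        using p one climbing_path_appendD(1)[of ?G A "z # B"] by (intro free) simp_all
      moreover have "length (z # B) \<le> mp G"
        using p one climbing_path_appendD(2)[of ?G A "z # B"] by (intro tail) simp_all
      ultimately show ?thesis
        using one by simp
    next
      case (two u v A B C)
      have uvC: "climbing_path ?G ((u # B) @ v # C)"
        using p two(1) climbing_path_appendD(2)[of ?G A "u # B @ v # C"] by simp
      have "length A \<le> mp G"
        using p two(1,3) climbing_path_appendD(1)[of ?G A "u # B @ v # C"] by (intro free) simp_all
      moreover have "length (u # B) \<le> mp G"
        using climbing_path_appendD(1)[OF uvC] two(4) by (rule tail)
      moreover have "length (v # C) \<le> mp G"
        using climbing_path_appendD(2)[OF uvC] two(5) by (rule tail)
      ultimately show ?thesis
        using two by simp
    qed
  qed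
qed

lemma mp_le_mp_add_edge: "mp G + 1 \<le> 3 * mp (add_edge G {x, y})"
proof -
  let ?G = "add_edge G {x, y}"
  \<comment> \<open>Positivity makes the truncated subtraction below harmless. It also absorbs the
    -1 when the path meets at most one end and so has at most two pieces.\<close>
  have pos: "mp ?G > 0"
    by (rule mp_pos[OF simple_graph_add_edge])
  have "mp G \<le> 3 * mp ?G - 1"
  proof (rule mp_leI[OF G])
    fix p assume p: "climbing_path G p"
    have init: "climbing_path ?G (D @ [z])"
      if "climbing_path G (D @ [z])" "{x, y} \<inter> set D = {}" for z D
    proof -
      have "successively (climb G) (D @ [z])"
        using that by (simp add: climbing_path_def)
      then have "successively (climb ?G) (D @ [z])"
        by (rule successively_snoc_mono) (use that in \<open>auto intro: climb_imp_climb_add_edge\<close>)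
      then show ?thesis
        using that by (simp add: climbing_path_def)
    qed
    have free: "length D \<le> mp ?G"
      if "climbing_path G D" "{x, y} \<inter> set D = {}" for D
    proof (cases D rule: rev_cases)
      case (snoc D' z)
      with that init[of D' z] have "climbing_path ?G D"
        by auto
      then show ?thesis
        by (rule length_climbing_path_le_mp[OF simple_graph_add_edge])
    qed simp
    from p have dist: "distinct p"
      by (simp add: climbing_path_def)
    then show "length p \<le> 3 * mp ?G - 1"
    proof (cases rule: distinct_list_split2_cases[where x = x and y = y])
      case none
      then show ?thesis
        using p free[of p] pos by simp
    next
      case (one z A B)
      have "climbing_path G ((A @ [z]) @ B)"
        using p one(1) by simp
      note parts = climbing_path_appendD[OF this]
      have "length (A @ [z]) \<le> mp ?G"
        by (rule length_climbing_path_le_mp[OF simple_graph_add_edge init[OF parts(1) one(2)]])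
      moreover have "length B \<le> mp ?G"
        using parts(2) one(3) by (rule free)
      ultimately show ?thesis
        using one pos by simp
    next
      case (two u v A B C)
      have "climbing_path G ((A @ [u]) @ (B @ [v]) @ C)"
        using p two(1) by simp
      note parts = climbing_path_appendD(1)[OF this]
        climbing_path_appendD[OF climbing_path_appendD(2)[OF this]]
      \<comment> \<open>The degrees of \<open>u\<close> and \<open>v\<close> are in order along
        \<open>p\<close> and both rise by one, so the new edge is itself an ascending step from
        \<open>u\<close> to \<open>v\<close>.\<close>
      have "successively (\<lambda>u v. degree G u \<le> degree G v) p"
        using p by (simp add: climbing_path_def successively_climb)
      then have "sorted (map (degree G) p)"
        by (simp add: successively_conv_sorted_wrt[symmetric] transp_def successively_map)
      then have "degree G u \<le> degree G v"
        by (simp add: two(1) sorted_append)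
      moreover have "degree ?G u = Suc (degree G u)" "degree ?G v = Suc (degree G v)"
        using two(2) by (auto intro!: degree_add_edge_end)
      ultimately have "climb ?G u v"
        using two(2) by (simp add: climb_def adjacent_add_edge)
      moreover have "climbing_path ?G (A @ [u])"
        using parts(1) two(3) by (rule init)
      moreover have "v \<in> verts G"
        using parts(2) by (simp add: climbing_path_def)
      ultimately have "climbing_path ?G (A @ [u, v])"
        using dist two(1) by (auto simp: climbing_path_def successively_append_iff)
      then have "length (A @ [u, v]) \<le> mp ?G"
        by (rule length_climbing_path_le_mp[OF simple_graph_add_edge])
      moreover have "length (B @ [v]) \<le> mp ?G"
        by (rule length_climbing_path_le_mp[OF simple_graph_add_edge init[OF parts(2) two(4)]])
      moreover have "length C \<le> mp ?G"
        using parts(3) two(5) by (rule free)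
      \<comment> \<open>The vertex \<open>v\<close> is counted in both \<open>A @ [u, v]\<close> and
        \<open>B @ [v]\<close>, so the three lengths add up to \<open>length p + 1\<close>.\<close>
      ultimately show ?thesis
        using two(1) by simp
    qed
  qed
  with pos show ?thesis
    by simp
qed

end

lemma non_edges_bounds:
  assumes "simple_graph G" "e \<in> non_edges G"
  shows "simple_graph (add_edge G e)" "mp (add_edge G e) \<le> 3 * mp G"
    "mp G + 1 \<le> 3 * mp (add_edge G e)"
  using assms simple_graph_add_edge mp_add_edge_le mp_le_mp_add_edge
  by (auto simp: non_edges_def)

lemma delete_add_edge:
  assumes "e \<in> non_edges G"
  shows "e \<in> edges (add_edge G e)" "delete_edge (add_edge G e) e = G"
  using assms by (auto simp: add_edge_def delete_edge_def non_edges_def adjacent_def)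

text \<open>Every deletion undoes an addition, so the bounds for adding \<open>e\<close> to
  \<open>delete_edge G e\<close> are the bounds for deleting \<open>e\<close> from
  \<open>G\<close>.\<close>

lemma add_delete_edge:
  assumes "simple_graph G" "e \<in> edges G"
  shows "simple_graph (delete_edge G e)" "e \<in> non_edges (delete_edge G e)"
    "add_edge (delete_edge G e) e = G"
proof -
  have "e \<subseteq> verts G" "card e = 2"
    using assms by (auto simp: simple_graph_def)
  then show "e \<in> non_edges (delete_edge G e)"
    by (auto simp: non_edges_def delete_edge_def adjacent_def card_2_iff)
qed (use assms in \<open>auto simp: simple_graph_def delete_edge_def add_edge_def insert_absorb\<close>)

section \<open>Extremal examples\<close>

text \<open>With an explicit edge list, adjacency and degrees can be evaluated by
  simplification.\<close>

definition graph_of_list :: "nat \<Rightarrow> (nat \<times> nat) list \<Rightarrow> nat graph" where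
  "graph_of_list n es = \<lparr>verts = {..<n}, edges = (\<lambda>(u, v). {u, v}) ` set es\<rparr>"

lemma verts_graph_of_list: "verts (graph_of_list n es) = {..<n}"
  by (simp add: graph_of_list_def)

lemma adjacent_graph_of_list:
  "adjacent (graph_of_list n es) u v \<longleftrightarrow> (u, v) \<in> set es \<or> (v, u) \<in> set es"
  by (force simp: adjacent_def graph_of_list_def doubleton_eq_iff)

lemma degree_graph_of_list:
  "degree (graph_of_list n es) v
    = length (filter (\<lambda>u. (v, u) \<in> set es \<or> (u, v) \<in> set es) [0..<n])"
proof -
  have "{u \<in> verts (graph_of_list n es). adjacent (graph_of_list n es) v u}
      = set (filter (\<lambda>u. (v, u) \<in> set es \<or> (u, v) \<in> set es) [0..<n])"
    by (auto simp: verts_graph_of_list adjacent_graph_of_list)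
  then show ?thesis
    unfolding degree_def by (simp only: distinct_card distinct_filter distinct_upt)
qed

lemma simple_graph_of_list:
  assumes "n > 0" "\<forall>(u, v) \<in> set es. u < n \<and> v < n \<and> u \<noteq> v"
  shows "simple_graph (graph_of_list n es)"
  using assms by (fastforce simp: simple_graph_def graph_of_list_def)

lemma non_edges_graph_of_listI:
  assumes "u < n" "v < n" "u \<noteq> v" "(u, v) \<notin> set es" "(v, u) \<notin> set es"
  shows "{u, v} \<in> non_edges (graph_of_list n es)"
  unfolding non_edges_def verts_graph_of_list adjacent_graph_of_list using assms by blast

lemma add_edge_graph_of_list:
  "add_edge (graph_of_list n es) {u, v} = graph_of_list n ((u, v) # es)"
  by (simp add: add_edge_def graph_of_list_def)

text \<open>Every edge joins different degrees, so it is ascended in one direction only, and the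
  level list \<open>l\<close> grows in that direction.\<close>

lemma mp_graph_of_list_le_levels:
  assumes "simple_graph (graph_of_list n es)"
    and "\<forall>(u, v) \<in> set es.
      (degree (graph_of_list n es) u < degree (graph_of_list n es) v \<and> l ! u < l ! v) \<or>
      (degree (graph_of_list n es) v < degree (graph_of_list n es) u \<and> l ! v < l ! u)"
    and "length l = n" "\<forall>i \<in> set l. i < k"
  shows "mp (graph_of_list n es) \<le> k"
  using assms(1)
proof (rule mp_le_levels)
  show "l ! u < l ! v" if "climb (graph_of_list n es) u v" for u v
    using that assms(2) by (fastforce simp: climb_def adjacent_graph_of_list)
  show "l ! v < k" if "v \<in> verts (graph_of_list n es)" for v
    using that assms(3,4) by (simp add: verts_graph_of_list)
qed

text \<open>The spine is the path \<open>0, 1, 2, 3, 4\<close>; adding the edge between 1 and 3 makes all five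
  spine vertices cubic, so that 5, 0, 1, 2, 3, 4 becomes degree monotone.\<close>

lemma upper_bound_attained:
  obtains G :: "nat graph" and e where "simple_graph G" "e \<in> non_edges G"
    "mp (add_edge G e) = 3 * mp G"
proof -
  define es :: "(nat \<times> nat) list" where "es =
    [(0, 1), (1, 2), (2, 3), (3, 4), (0, 5), (0, 6), (2, 7), (4, 8), (4, 9)]"
  define G where "G = graph_of_list 10 es"
  have G: "simple_graph G"
    unfolding G_def es_def by (rule simple_graph_of_list) simp_all
  have e: "{1, 3} \<in> non_edges G"
    unfolding G_def es_def by (rule non_edges_graph_of_listI) simp_all
  have "mp G \<le> 2"
    using G unfolding G_def
  proof (rule mp_graph_of_list_le_levels)
    \<comment> \<open>Level 1 marks the cubic vertices 0, 2, 4; every edge joins one of them to a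
      vertex of smaller degree.\<close>
    show "length [1, 0, 1, 0, 1, 0, 0, 0, 0, 0 :: nat] = 10" by simp
  qed (simp_all add: es_def degree_graph_of_list upt_rec)
  moreover have "climbing_path (add_edge G {1, 3}) [5, 0, 1, 2, 3, 4]"
    by (simp add: climbing_path_def G_def es_def add_edge_graph_of_list verts_graph_of_list
        climb_def adjacent_graph_of_list degree_graph_of_list upt_rec)
  then have "6 \<le> mp (add_edge G {1, 3})"
    using length_climbing_path_le_mp[OF non_edges_bounds(1)[OF G e]] by fastforce
  \<comment> \<open>The chain 6 \<le> \<open>mp (add_edge G {1, 3})\<close> \<le>
    \<open>3 * mp G\<close> \<le> 6 forces equality.\<close>
  ultimately have "mp (add_edge G {1, 3}) = 3 * mp G"
    using non_edges_bounds(2)[OF G e] by simp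
  with G e show thesis
    by (rule that)
qed

text \<open>The path \<open>0, 1, 2, 3, 4, 5, 6, 7\<close> has degrees 1, 2, 2, 3, 3, 3, 4, 5. Adding the edge between
  1 and 4 makes all edges join vertices of different degrees, with no ascent longer than 3.\<close>

lemma lower_bound_attained:
  obtains G :: "nat graph" and e where "simple_graph G" "e \<in> non_edges G"
    "mp G + 1 = 3 * mp (add_edge G e)"
proof -
  define es :: "(nat \<times> nat) list" where "es =
    [(0, 1), (1, 2), (2, 3), (3, 4), (4, 5), (5, 6), (6, 7), (5, 7), (3, 8), (4, 9), (6, 10),
      (6, 11), (7, 12), (7, 13), (7, 14)]"
  define G where "G = graph_of_list 15 es"
  have G: "simple_graph G"
    unfolding G_def es_def by (rule simple_graph_of_list) simp_all
  have e: "{1, 4} \<in> non_edges G"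
    unfolding G_def es_def by (rule non_edges_graph_of_listI) simp_all
  have "mp (add_edge G {1, 4}) \<le> 3"
    using non_edges_bounds(1)[OF G e] unfolding G_def add_edge_graph_of_list
  proof (rule mp_graph_of_list_le_levels)
    \<comment> \<open>The levels are the positions in the ascents 0, 1, 4 and 2, 3, 4 and 5, 6, 7,
      the three pieces of the lower bound proof, here all of length 3. The leaves 8 to 14 have level
      0.\<close>
    show "length [0, 1, 0, 1, 2, 0, 1, 2, 0, 0, 0, 0, 0, 0, 0 :: nat] = 15" by simp
  qed (simp_all add: es_def degree_graph_of_list upt_rec)
  moreover have "climbing_path G [0, 1, 2, 3, 4, 5, 6, 7]"
    by (simp add: climbing_path_def G_def es_def verts_graph_of_list
        climb_def adjacent_graph_of_list degree_graph_of_list upt_rec)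
  then have "8 \<le> mp G"
    using length_climbing_path_le_mp[OF G] by fastforce
  ultimately have "mp G + 1 = 3 * mp (add_edge G {1, 4})"
    using non_edges_bounds(3)[OF G e] by simp
  with G e show thesis
    by (rule that)
qed

theorem theorem2p1:
  shows
    "(\<forall>G :: 'a graph. simple_graph G \<longrightarrow>
        (\<forall>e \<in> non_edges G.
           (real (mp G) + 1) / 3 \<le> real (mp (add_edge G e)) \<and>
           real (mp (add_edge G e)) \<le> 3 * real (mp G)) \<and>
        (\<forall>e \<in> edges G.
           real (mp G) / 3 \<le> real (mp (delete_edge G e)) \<and>
           real (mp (delete_edge G e)) \<le> 3 * real (mp G) - 1)) \<and>
     (\<exists>G :: nat graph. simple_graph G \<and>
        (\<exists>e \<in> non_edges G. (real (mp G) + 1) / 3 = real (mp (add_edge G e)))) \<and>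
     (\<exists>G :: nat graph. simple_graph G \<and>
        (\<exists>e \<in> non_edges G. real (mp (add_edge G e)) = 3 * real (mp G))) \<and>
     (\<exists>G :: nat graph. simple_graph G \<and>
        (\<exists>e \<in> edges G. real (mp G) / 3 = real (mp (delete_edge G e)))) \<and>
     (\<exists>G :: nat graph. simple_graph G \<and>
        (\<exists>e \<in> edges G. real (mp (delete_edge G e)) = 3 * real (mp G) - 1))"
proof -
  have "(real (mp G) + 1) / 3 \<le> real (mp (add_edge G e)) \<and>
      real (mp (add_edge G e)) \<le> 3 * real (mp G)"
    if "simple_graph G" "e \<in> non_edges G" for G :: "'a graph" and e
    using non_edges_bounds(2,3)[OF that] by simp
  moreover have "real (mp G) / 3 \<le> real (mp (delete_edge G e)) \<and>
      real (mp (delete_edge G e)) \<le> 3 * real (mp G) - 1"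
    if "simple_graph G" "e \<in> edges G" for G :: "'a graph" and e
    using non_edges_bounds(2,3)[OF add_delete_edge(1,2)[OF that]]
    unfolding add_delete_edge(3)[OF that] by simp
  moreover obtain G :: "nat graph" and e where G: "simple_graph G" "e \<in> non_edges G"
    "mp (add_edge G e) = 3 * mp G"
    by (rule upper_bound_attained)
  \<comment> \<open>Deleting the added edge again turns an extremal example for addition into one
    for deletion: \<open>G\<close> gives the lower deletion bound, and \<open>H\<close> below gives
    the upper one.\<close>
  moreover have "real (mp (add_edge G e)) = 3 * real (mp G)"
    "real (mp (add_edge G e)) / 3 = real (mp (delete_edge (add_edge G e) e))"
    using G delete_add_edge(2)[OF G(2)] by simp_all
  moreover obtain H :: "nat graph" and f where H: "simple_graph H" "f \<in> non_edges H"
    "mp H + 1 = 3 * mp (add_edge H f)"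
    by (rule lower_bound_attained)
  moreover from H(3) have "real (mp H) + 1 = 3 * real (mp (add_edge H f))"
    by (metis of_nat_1 of_nat_add of_nat_mult of_nat_numeral)
  then have "(real (mp H) + 1) / 3 = real (mp (add_edge H f))"
    "real (mp (delete_edge (add_edge H f) f)) = 3 * real (mp (add_edge H f)) - 1"
    unfolding delete_add_edge(2)[OF H(2)] by simp_all
  ultimately show ?thesis
    using non_edges_bounds(1) delete_add_edge(1) by (intro conjI) blast+
qed

end
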